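(* Let $k\ge 1$ be an integer. Let $\mathcal X_n=(\mathbb X_n,d_n,\mu_n)$, $n\ge 1$, and $\mathcal X=(\mathbb X,d,\mu)$ be compact normalized metric measure spaces such that $\mathcal X_n\to\mathcal X$ in the measured Gromov–Hausdorff sense. Let $h_n\colon \mathbb X_n\to\mathbb X$ be any sequence of $\varepsilon_n$-isometries involved in this convergence (i.e. $\varepsilon_n\to 0$ and $(h_n)_{\#}\mu_n\to\mu$ weakly). Then, for any $p\ge 1$, $$\lim_{n\to\infty}\ \max_{S_n\in\mathcal S_{\mathcal X_n}(k)}\ \min_{S\in\mathcal S_{\mathcal X}(k)} d_H(h_n(S_n),S)=0 .$$
   Context: A normalized metric measure space is a metric space with a Borel probability measure. A map $h\colon(\mathbb X,d_{\mathbb X})\to(\mathbb Y,d_{\mathbb Y})$ is an $\varepsilon$-isometry if $|d_{\mathbb X}(x,x')-d_{\mathbb Y}(h(x),h(x'))|<\varepsilon$ for all $x,x'\in\mathbb X$, and $d_{\mathbb Y}(y,h(\mathbb X))<\varepsilon$ for all $y\in\mathbb Y$. Compact normalized metric measure spaces $(\mathbb X_n,d_n,\mu_n)$ converge to a compact normalized metric measure space $(\mathbb X,d,\mu)$ in the measured Gromov–Hausdorff (mGH) sense if there are numbers $\varepsilon_n\to0$ and (Borel measurable) $\varepsilon_n$-isometries $h_n\colon\mathbb X_n\to\mathbb X$ with $(h_n)_{\#}\mu_n\to\mu$ weakly on $\mathbb X$. For a compact metric space $(\mathbb Y,d_{\mathbb Y})$, $C_k(\mathbb Y)$ is the set of all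 (nonempty) subsets of $\mathbb Y$ of cardinality at most $k$, and for $A,B\in C_k(\mathbb Y)$ the Hausdorff distance is $d_H(A,B)=\max\{\max_{a\in A}d_{\mathbb Y}(a,B),\max_{b\in B}d_{\mathbb Y}(b,A)\}$, where $d_{\mathbb Y}(x,C)=\min_{c\in C}d_{\mathbb Y}(x,c)$. For a Borel probability measure $\nu$ on $\mathbb Y$ and $S\in C_k(\mathbb Y)$ put $\Phi_{\mathbb Y}(S,\nu)=\int_{\mathbb Y}\min_{x\in S}d_{\mathbb Y}(y,x)^p\,\nu(dy)$. For $\mathcal Y=(\mathbb Y,d_{\mathbb Y},\nu)$, the set of $k$-means is $\mathcal S_{\mathcal Y}(k)=\{S\in C_k(\mathbb Y):\Phi_{\mathbb Y}(S,\nu)\le\Phi_{\mathbb Y}(A,\nu)\ \text{for all }A\in C_k(\mathbb Y)\}$. In the claim, $d_H$ is the Hausdorff distance on $C_k(\mathbb X)$. *)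

theory Defs
  imports "HOL-Probability.Probability"
begin

text \<open>
  A metric measure space is given by a library metric \<open>X :: 'a metric\<close> (carrier \<open>mspace X\<close>,
  distance \<open>mdist X\<close>) and a measure on its Borel sets. The library constant \<open>borel\<close> is tied
  to type classes, so the Borel sigma-algebra of the carrier is introduced here.
\<close>

definition mborel :: "'a metric \<Rightarrow> 'a measure" where
  "mborel X = sigma (mspace X) {U. openin (mtopology_of X) U}"

text \<open>Nonemptiness of the carrier is implied by \<open>prob_space\<close>.\<close>

definition compact_nmms :: "'a metric \<Rightarrow> 'a measure \<Rightarrow> bool" where
  "compact_nmms X \<mu> \<longleftrightarrow>
     compact_space (mtopology_of X) \<and> prob_space \<mu> \<and>
     space \<mu> = mspace X \<and> sets \<mu> = sets (mborel X)"

text \<open>Distance of a point to a nonempty set; for finite sets the infimum is a minimum.\<close>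

definition point_setdist :: "'a metric \<Rightarrow> 'a \<Rightarrow> 'a set \<Rightarrow> real" where
  "point_setdist X x C = (INF c\<in>C. mdist X x c)"

definition eps_isometry :: "'a metric \<Rightarrow> 'b metric \<Rightarrow> real \<Rightarrow> ('a \<Rightarrow> 'b) \<Rightarrow> bool" where
  "eps_isometry X Y \<epsilon> h \<longleftrightarrow>
     h \<in> mspace X \<rightarrow> mspace Y \<and>
     (\<forall>x\<in>mspace X. \<forall>x'\<in>mspace X. \<bar>mdist X x x' - mdist Y (h x) (h x')\<bar> < \<epsilon>) \<and>
     (\<forall>y\<in>mspace Y. point_setdist Y y (h ` mspace X) < \<epsilon>)"

text \<open>The library notion \<open>weak_conv_m\<close> covers measures on the real line only.\<close>

definition weakly_converges ::
    "'a metric \<Rightarrow> (nat \<Rightarrow> 'a measure) \<Rightarrow> 'a measure \<Rightarrow> bool" where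
  "weakly_converges X \<nu>s \<nu> \<longleftrightarrow>
     (\<forall>f :: 'a \<Rightarrow> real.
        continuous_map (mtopology_of X) euclideanreal f \<and> bounded (f ` mspace X) \<longrightarrow>
        (\<lambda>n. \<integral>y. f y \<partial>\<nu>s n) \<longlonglongrightarrow> (\<integral>y. f y \<partial>\<nu>))"

definition mGH_converges_via ::
    "(nat \<Rightarrow> 'a metric) \<Rightarrow> (nat \<Rightarrow> 'a measure) \<Rightarrow> 'b metric \<Rightarrow> 'b measure \<Rightarrow>
     (nat \<Rightarrow> real) \<Rightarrow> (nat \<Rightarrow> 'a \<Rightarrow> 'b) \<Rightarrow> bool" where
  "mGH_converges_via Xs \<mu>s X \<mu> \<epsilon> h \<longleftrightarrow>
     \<epsilon> \<longlonglongrightarrow> 0 \<and>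
     (\<forall>n. eps_isometry (Xs n) X (\<epsilon> n) (h n) \<and> h n \<in> \<mu>s n \<rightarrow>\<^sub>M mborel X) \<and>
     weakly_converges X (\<lambda>n. distr (\<mu>s n) (mborel X) (h n)) \<mu>"

definition mGH_converges ::
    "(nat \<Rightarrow> 'a metric) \<Rightarrow> (nat \<Rightarrow> 'a measure) \<Rightarrow> 'b metric \<Rightarrow> 'b measure \<Rightarrow> bool" where
  "mGH_converges Xs \<mu>s X \<mu> \<longleftrightarrow> (\<exists>\<epsilon> h. mGH_converges_via Xs \<mu>s X \<mu> \<epsilon> h)"

definition C_sets :: "nat \<Rightarrow> 'a metric \<Rightarrow> 'a set set" where
  "C_sets k Y = {S. S \<subseteq> mspace Y \<and> S \<noteq> {} \<and> finite S \<and> card S \<le> k}"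

text \<open>Hausdorff distance of finite nonempty sets.\<close>

definition hausdorff_dist :: "'a metric \<Rightarrow> 'a set \<Rightarrow> 'a set \<Rightarrow> real" where
  "hausdorff_dist Y A B =
     max (Max ((\<lambda>a. point_setdist Y a B) ` A)) (Max ((\<lambda>b. point_setdist Y b A) ` B))"

definition Phi :: "real \<Rightarrow> 'a metric \<Rightarrow> 'a set \<Rightarrow> 'a measure \<Rightarrow> real" where
  "Phi p Y S \<nu> = (\<integral>y. Min ((\<lambda>x. mdist Y y x powr p) ` S) \<partial>\<nu>)"

definition k_means :: "real \<Rightarrow> nat \<Rightarrow> 'a metric \<Rightarrow> 'a measure \<Rightarrow> 'a set set" where
  "k_means p k Y \<nu> = {S \<in> C_sets k Y. \<forall>A\<in>C_sets k Y. Phi p Y S \<nu> \<le> Phi p Y A \<nu>}"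

text \<open>
  In \<open>max S\<^sub>n. min S. d\<^sub>H (h\<^sub>n S\<^sub>n) S\<close> the maximum need not be attained, because the maps \<open>h\<^sub>n\<close> are
  not assumed continuous, so it is to be read as a supremum. Supremum and infimum over sets of
  k-means are best taken in \<open>ereal\<close>: the conventions for the empty set (supremum \<open>-\<infinity>\<close>,
  infimum \<open>\<infinity>\<close>) keep convergence to 0 from holding merely because such a set is empty.
\<close>

end

theory Submission
  imports Defs
begin

text \<open>
  The functional \<open>\<Phi>\<close> is stable: replacing the distances \<open>d(y, x)\<close> to the centres by distances that
  are larger by at most \<open>e\<close> raises it by at most \<open>p D\<^bsup>p-1\<^esup> e\<close>, where \<open>D\<close> bounds the diameters. Along
  any subsequence the images \<open>h\<^sub>n(S\<^sub>n)\<close> accumulate, as \<open>k\<close>-tuples in the compact space \<open>X\<close>, at some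
  \<open>T\<close>. Lifting a competitor \<open>A\<close> in \<open>X\<close> through \<open>h\<^sub>n\<close> to competitors of \<open>S\<^sub>n\<close>, stability bounds
  \<open>\<Phi>(T, (h\<^sub>n)\<^sub>#\<mu>\<^sub>n)\<close> by \<open>\<Phi>(A, (h\<^sub>n)\<^sub>#\<mu>\<^sub>n) + o(1)\<close>, and weak convergence makes \<open>T\<close> a set of
  \<open>k\<close>-means of \<open>X\<close>. Hence no subsequence stays away from the \<open>k\<close>-means of \<open>X\<close>.
\<close>

section \<open>Stability of the cost under perturbation of the distances\<close>

text \<open>Mean value theorem: between \<open>b\<close> and \<open>a\<close> the derivative of t^p
  is at most p D^(p-1), because p >= 1 and the interval ends at \<open>a\<close>, which is at most
  \<open>D\<close>.\<close>

lemma powr_le_powr_add: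
  fixes a b D e p :: real
  assumes "1 \<le> p" "0 \<le> a" "a \<le> D" "0 \<le> b" "a \<le> b + e" "0 \<le> e"
  shows "a powr p \<le> b powr p + p * D powr (p - 1) * e"
proof (cases "a \<le> b")
  case True
  then have "a powr p \<le> b powr p"
    using assms by (intro powr_mono2) auto
  moreover have "0 \<le> p * D powr (p - 1) * e"
    using assms by simp
  ultimately show ?thesis by linarith
next
  case False
  have cont: "continuous_on {b..a} (\<lambda>t. t powr p)"
    using assms by (intro continuous_on_powr' continuous_intros) auto
  have der: "((\<lambda>t. t powr p) has_real_derivative p * t powr (p - 1)) (at t)" if "b < t" for t
    using that assms by (intro has_real_derivative_powr) auto
  then have "(\<lambda>t. t powr p) differentiable (at t)" if "b < t" "t < a" for t
    using that by (auto simp: real_differentiable_def)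
  from MVT[OF _ cont this] False obtain l z where z: "b < z" "z < a"
    and l: "((\<lambda>t. t powr p) has_real_derivative l) (at z)" "a powr p - b powr p = (a - b) * l"
    by force
  have "l = p * z powr (p - 1)"
    using DERIV_unique[OF l(1) der[OF z(1)]] .
  \<comment> \<open>For p = 1 the convention that \<open>0 powr 0\<close> is 0 does no harm: 0 <= b
    < z < a <= D makes both bases positive.\<close>
  also have "\<dots> \<le> p * D powr (p - 1)"
    using assms z by (intro mult_left_mono powr_mono2) auto
  finally have "(a - b) * l \<le> e * (p * D powr (p - 1))"
    using assms False by (intro mult_mono') (use \<open>l = _\<close> in auto)
  then show ?thesis using l(2) by (simp add: mult.commute)
qed

lemma Min_image_le_add:
  fixes u v :: "'i \<Rightarrow> real"
  assumes "finite I" "I \<noteq> {}" "\<And>i. i \<in> I \<Longrightarrow> u i \<le> v i + c"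
  shows "Min (u ` I) \<le> Min (v ` I) + c"
proof -
  have "Min (v ` I) \<in> v ` I" using assms by simp
  then obtain i where i: "i \<in> I" "Min (v ` I) = v i" by auto
  have "Min (u ` I) \<le> u i" using i assms by simp
  with i assms(3) show ?thesis by fastforce
qed

lemma integrable_Min_powr:
  fixes u :: "'i \<Rightarrow> 'a \<Rightarrow> real"
  assumes "prob_space M" "finite I" "I \<noteq> {}" "0 \<le> p"
    and meas: "\<And>i. i \<in> I \<Longrightarrow> u i \<in> borel_measurable M"
    and bd: "\<And>i x. i \<in> I \<Longrightarrow> x \<in> space M \<Longrightarrow> 0 \<le> u i x \<and> u i x \<le> D"
  shows "integrable M (\<lambda>x. Min ((\<lambda>i. u i x powr p) ` I))"
proof -
  interpret prob_space M by fact
  have "norm (Min ((\<lambda>i. u i x powr p) ` I)) \<le> D powr p" if x: "x \<in> space M" for x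
  proof -
    have "Min ((\<lambda>i. u i x powr p) ` I) \<in> (\<lambda>i. u i x powr p) ` I"
      using assms by simp
    then obtain i where i: "i \<in> I" "Min ((\<lambda>i. u i x powr p) ` I) = u i x powr p" by auto
    show ?thesis unfolding i(2)
      using bd[OF i(1) x] \<open>0 \<le> p\<close> by (auto intro!: powr_mono2)
  qed
  moreover have "(\<lambda>x. Min ((\<lambda>i. u i x powr p) ` I)) \<in> borel_measurable M"
    using meas \<open>finite I\<close> by (intro borel_measurable_Min) measurable
  ultimately show ?thesis
    by (intro integrable_const_bound[where B = "D powr p"] AE_I2) auto
qed

text \<open>Centres are matched by index, so the pointwise estimate passes through the minimum and
  then through the integral. Total mass 1 keeps the additive constant unchanged.\<close>

lemma integral_Min_powr_le:
  fixes u v :: "'i \<Rightarrow> 'a \<Rightarrow> real"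
  assumes "prob_space M" "finite I" "I \<noteq> {}" "1 \<le> p" "0 \<le> e"
    and "\<And>i. i \<in> I \<Longrightarrow> u i \<in> borel_measurable M" "\<And>i. i \<in> I \<Longrightarrow> v i \<in> borel_measurable M"
    and u: "\<And>i x. i \<in> I \<Longrightarrow> x \<in> space M \<Longrightarrow> 0 \<le> u i x \<and> u i x \<le> D"
    and v: "\<And>i x. i \<in> I \<Longrightarrow> x \<in> space M \<Longrightarrow> 0 \<le> v i x \<and> v i x \<le> D"
    and uv: "\<And>i x. i \<in> I \<Longrightarrow> x \<in> space M \<Longrightarrow> u i x \<le> v i x + e"
  shows "(\<integral>x. Min ((\<lambda>i. u i x powr p) ` I) \<partial>M)
      \<le> (\<integral>x. Min ((\<lambda>i. v i x powr p) ` I) \<partial>M) + p * D powr (p - 1) * e"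
proof -
  interpret prob_space M by fact
  let ?U = "\<lambda>x. Min ((\<lambda>i. u i x powr p) ` I)" and ?V = "\<lambda>x. Min ((\<lambda>i. v i x powr p) ` I)"
  have "integrable M ?U" "integrable M ?V"
    using assms by (intro integrable_Min_powr[where D = D]; simp)+
  moreover have "?U x \<le> ?V x + p * D powr (p - 1) * e" if "x \<in> space M" for x
    using assms that by (intro Min_image_le_add powr_le_powr_add) auto
  ultimately have "(\<integral>x. ?U x \<partial>M) \<le> (\<integral>x. ?V x + p * D powr (p - 1) * e \<partial>M)"
    by (intro integral_mono) auto
  then show ?thesis
    using \<open>integrable M ?V\<close> by (simp add: prob_space)
qed

section \<open>Borel measurability, continuity of the integrand, and costs under
  push-forward\<close>

lemma space_mborel [simp]: "space (mborel X) = mspace X"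
  by (simp add: mborel_def space_measure_of_conv)

lemma continuous_map_imp_measurable_mborel:
  assumes "continuous_map (mtopology_of X) euclidean f"
  shows "f \<in> borel_measurable (mborel X)"
proof (rule borel_measurableI)
  fix S :: "'b set" assume "open S"
  then have "openin (mtopology_of X) {x \<in> mspace X. f x \<in> S}"
    using assms by (auto simp: continuous_map_def)
  moreover have "f -` S \<inter> space (mborel X) = {x \<in> mspace X. f x \<in> S}" by auto
  moreover have "{U. openin (mtopology_of X) U} \<subseteq> Pow (mspace X)"
    using openin_subset by fastforce
  ultimately show "f -` S \<inter> space (mborel X) \<in> sets (mborel X)"
    by (auto simp: mborel_def)
qed

lemma continuous_map_mdist_left:
  assumes "a \<in> mspace X"
  shows "continuous_map (mtopology_of X) euclideanreal (\<lambda>y. mdist X y a)"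
  using assms by (intro continuous_map_mdist) auto

lemma continuous_map_Min_mdist_powr:
  assumes "finite S" "S \<noteq> {}" "S \<subseteq> mspace X" "0 < p"
  shows "continuous_map (mtopology_of X) euclideanreal (\<lambda>y. Min ((\<lambda>x. mdist X y x powr p) ` S))"
proof -
  \<comment> \<open>The absolute value makes the power continuous on the whole line, so that it can
    be composed with the distance function. It disappears again because distances are
    nonnegative.\<close>
  have "continuous_on UNIV (\<lambda>t::real. \<bar>t\<bar> powr p)"
    by (rule continuous_on_powr') (use \<open>0 < p\<close> in \<open>auto intro: continuous_intros\<close>)
  then have cont: "continuous_map euclideanreal euclideanreal (\<lambda>t. \<bar>t\<bar> powr p)" by simp
  show ?thesis
    using assms(1-3)
  proof (induction rule: finite_ne_induct)
    case (singleton x)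
    with continuous_map_compose[OF continuous_map_mdist_left cont, of x X] show ?case
      by (simp add: o_def)
  next
    case (insert x S)
    with continuous_map_compose[OF continuous_map_mdist_left cont, of x X] show ?case
      by (simp add: o_def continuous_map_real_min)
  qed
qed

text \<open>Centres are treated as finite families, possibly with repetitions. Families in different
  spaces then share an index set and can be compared term by term.\<close>

lemma Phi_image: "Phi p Y (f ` I) \<nu> = (\<integral>y. Min ((\<lambda>i. mdist Y y (f i) powr p) ` I) \<partial>\<nu>)"
  by (simp add: Phi_def image_image)

lemma Phi_image_distr:
  assumes "h \<in> \<nu> \<rightarrow>\<^sub>M mborel X" "finite I" "g \<in> I \<rightarrow> mspace X"
  shows "Phi p X (g ` I) (distr \<nu> (mborel X) h)
    = (\<integral>y. Min ((\<lambda>i. mdist X (h y) (g i) powr p) ` I) \<partial>\<nu>)"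
proof -
  have "(\<lambda>y. mdist X y (g i)) \<in> borel_measurable (mborel X)" if "i \<in> I" for i
    using that assms by (intro continuous_map_imp_measurable_mborel continuous_map_mdist_left) auto
  then have "(\<lambda>y. Min ((\<lambda>i. mdist X y (g i) powr p) ` I)) \<in> borel_measurable (mborel X)"
    using \<open>finite I\<close> by (intro borel_measurable_Min) measurable
  then show ?thesis
    unfolding Phi_image using assms(1) by (subst integral_distr) auto
qed

lemma Phi_nonneg:
  assumes "finite S" "S \<noteq> {}"
  shows "0 \<le> Phi p Y S \<nu>"
  unfolding Phi_def using assms by (intro Bochner_Integration.integral_nonneg) auto

text \<open>Change of variables along \<open>h\<close> turns both costs into integrals over
  \<open>Y\<close> against the same measure, where the estimate for matched centres applies. Each
  direction asks only for the one-sided distance bound that it uses, and \<open>h\<close> need only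
  be Borel.\<close>

lemma Phi_comparison:
  assumes Y: "compact_nmms Y \<nu>" and h: "h \<in> \<nu> \<rightarrow>\<^sub>M mborel X"
    and I: "finite I" "I \<noteq> {}" "f \<in> I \<rightarrow> mspace Y" "g \<in> I \<rightarrow> mspace X" and p: "1 \<le> p"
    and DY: "\<And>a b. a \<in> mspace Y \<Longrightarrow> b \<in> mspace Y \<Longrightarrow> mdist Y a b \<le> D"
    and DX: "\<And>a b. a \<in> mspace X \<Longrightarrow> b \<in> mspace X \<Longrightarrow> mdist X a b \<le> D"
    and e: "0 \<le> e"
  shows Phi_le_Phi_distr:
      "(\<And>i y. i \<in> I \<Longrightarrow> y \<in> mspace Y \<Longrightarrow> mdist Y y (f i) \<le> mdist X (h y) (g i) + e) \<Longrightarrow>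
       Phi p Y (f ` I) \<nu> \<le> Phi p X (g ` I) (distr \<nu> (mborel X) h) + p * D powr (p - 1) * e"
    and Phi_distr_le_Phi:
      "(\<And>i y. i \<in> I \<Longrightarrow> y \<in> mspace Y \<Longrightarrow> mdist X (h y) (g i) \<le> mdist Y y (f i) + e) \<Longrightarrow>
       Phi p X (g ` I) (distr \<nu> (mborel X) h) \<le> Phi p Y (f ` I) \<nu> + p * D powr (p - 1) * e"
proof -
  have sp: "space \<nu> = mspace Y" and se: "sets \<nu> = sets (mborel Y)" and pr: "prob_space \<nu>"
    using Y by (auto simp: compact_nmms_def)
  have mf: "(\<lambda>y. mdist Y y (f i)) \<in> borel_measurable \<nu>" if "i \<in> I" for i
    using that I continuous_map_imp_measurable_mborel[OF continuous_map_mdist_left[of "f i" Y]]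
      measurable_cong_sets[OF se refl] by blast
  have mg: "(\<lambda>y. mdist X (h y) (g i)) \<in> borel_measurable \<nu>" if "i \<in> I" for i
    using that I measurable_compose[OF h continuous_map_imp_measurable_mborel[OF continuous_map_mdist_left[of "g i" X]]]
    by blast
  have hs: "h y \<in> mspace X" if "y \<in> mspace Y" for y
    using measurable_space[OF h, of y] that sp by simp
  have fg: "f i \<in> mspace Y" "g i \<in> mspace X" if "i \<in> I" for i
    using that I by auto
  note distr = Phi_image_distr[OF h I(1,4)]
  show "Phi p Y (f ` I) \<nu> \<le> Phi p X (g ` I) (distr \<nu> (mborel X) h) + p * D powr (p - 1) * e"
    if "\<And>i y. i \<in> I \<Longrightarrow> y \<in> mspace Y \<Longrightarrow> mdist Y y (f i) \<le> mdist X (h y) (g i) + e"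
    unfolding distr Phi_image[of p Y]
    by (rule integral_Min_powr_le[OF pr I(1,2) p e mf mg]) (use sp in \<open>auto intro: that DX DY hs fg\<close>)
  show "Phi p X (g ` I) (distr \<nu> (mborel X) h) \<le> Phi p Y (f ` I) \<nu> + p * D powr (p - 1) * e"
    if "\<And>i y. i \<in> I \<Longrightarrow> y \<in> mspace Y \<Longrightarrow> mdist X (h y) (g i) \<le> mdist Y y (f i) + e"
    unfolding distr Phi_image[of p Y]
    by (rule integral_Min_powr_le[OF pr I(1,2) p e mg mf]) (use sp in \<open>auto intro: that DX DY hs fg\<close>)
qed

section \<open>Compactness: bounded diameter and convergent subsequences of tuples\<close>

lemma compact_mdist_bounded:
  assumes "compact_space (mtopology_of X)"
  obtains D where "\<And>a b. a \<in> mspace X \<Longrightarrow> b \<in> mspace X \<Longrightarrow> mdist X a b \<le> D"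
proof -
  interpret Metric_space "mspace X" "mdist X" by simp
  have "mbounded (mspace X)"
    using assms by (intro compactin_imp_mbounded) (simp add: compact_space_def mtopology_of_def)
  then show thesis using that by (auto simp: mbounded_alt)
qed

lemma compact_convergent_subseq:
  fixes x :: "nat \<Rightarrow> 'a"
  assumes "compact_space (mtopology_of X)" "\<And>n. x n \<in> mspace X"
  obtains l r where "l \<in> mspace X" "strict_mono r" "(\<lambda>n. mdist X (x (r n)) l) \<longlonglongrightarrow> 0"
proof -
  interpret Metric_space "mspace X" "mdist X" by simp
  have "compactin mtopology (mspace X)"
    using assms by (simp add: compact_space_def mtopology_of_def)
  then have "\<exists>l r. l \<in> mspace X \<and> strict_mono r \<and> limitin mtopology (x \<circ> r) l sequentially"
    by (intro Bolzano_Weierstrass_B[OF subset_refl] Bolzano_Weierstrass_A) (use assms(2) in auto)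
  then show thesis using that by (auto simp: limitin_metric_dist_null o_def)
qed

text \<open>Induction on the number of coordinates, with a further subsequence for each new one.
  Summing the distances gives a single null sequence that controls all coordinates at once.\<close>

lemma compact_tuple_convergent_subseq:
  fixes k :: nat
  assumes "compact_space (mtopology_of X)"
    and "\<And>n i. i < k \<Longrightarrow> x n i \<in> mspace X"
  obtains l r where "l \<in> {..<k} \<rightarrow> mspace X" "strict_mono (r :: nat \<Rightarrow> nat)"
    "(\<lambda>n. \<Sum>i<k. mdist X (x (r n) i) (l i)) \<longlonglongrightarrow> 0"
proof -
  have "\<exists>l r. l \<in> {..<k} \<rightarrow> mspace X \<and> strict_mono (r :: nat \<Rightarrow> nat) \<and>
          (\<lambda>n. \<Sum>i<k. mdist X (x (r n) i) (l i)) \<longlonglongrightarrow> 0"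
    using assms(2)
  proof (induction k)
    case 0
    have "strict_mono (id :: nat \<Rightarrow> nat)" by (simp add: strict_mono_def)
    then show ?case by auto
  next
    case (Suc k)
    then obtain l r where l: "l \<in> {..<k} \<rightarrow> mspace X" and r: "strict_mono (r :: nat \<Rightarrow> nat)"
      and lim: "(\<lambda>n. \<Sum>i<k. mdist X (x (r n) i) (l i)) \<longlonglongrightarrow> 0"
      by auto
    obtain m s where m: "m \<in> mspace X" and s: "strict_mono s"
      and lim': "(\<lambda>n. mdist X (x (r (s n)) k) m) \<longlonglongrightarrow> 0"
      using compact_convergent_subseq[OF assms(1), of "\<lambda>n. x (r n) k"] Suc.prems by auto
    let ?l = "l(k := m)"
    have "(\<lambda>n. (\<Sum>i<k. mdist X (x (r (s n)) i) (l i)) + mdist X (x (r (s n)) k) m) \<longlonglongrightarrow> 0 + 0"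
      using LIMSEQ_subseq_LIMSEQ[OF lim s] lim' by (intro tendsto_add) (auto simp: o_def)
    then have "(\<lambda>n. \<Sum>i<Suc k. mdist X (x ((r \<circ> s) n) i) (?l i)) \<longlonglongrightarrow> 0" by simp
    moreover have "?l \<in> {..<Suc k} \<rightarrow> mspace X" using l m by (auto simp: less_Suc_eq)
    moreover have "strict_mono (r \<circ> s)" using r s by (rule strict_mono_o)
    ultimately show ?case by blast
  qed
  then show thesis using that by blast
qed

section \<open>Sets of at most k points as k-tuples, and existence of k-means\<close>

text \<open>A set with fewer than k points becomes a k-tuple by repeating one of its points.
  Compactness arguments can thus run coordinatewise, and points that merge in a limit need no
  separate treatment.\<close>

lemma C_sets_eq_tuples:
  assumes "1 \<le> k"
  shows "C_sets k Y = (\<lambda>f. f ` {..<k}) ` ({..<k} \<rightarrow> mspace Y)"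
proof (intro equalityI subsetI)
  fix S assume "S \<in> C_sets k Y"
  then have S: "S \<subseteq> mspace Y" "S \<noteq> {}" "finite S" "card S \<le> k" by (auto simp: C_sets_def)
  obtain g where g: "S = g ` {..<card S}"
    by (metis finite_imp_nat_seg_image_inj_on[OF S(3)] card_image card_lessThan lessThan_def)
  \<comment> \<open>The padding value \<open>g 0\<close> belongs to \<open>S\<close> because
    \<open>S\<close> is nonempty.\<close>
  define f where "f i = (if i < card S then g i else g 0)" for i
  have "0 < card S" using S by auto
  then have "S = f ` {..<k}"
    using S(4) by (subst g) (auto simp: f_def image_iff; metis less_le_trans)
  then show "S \<in> (\<lambda>f. f ` {..<k}) ` ({..<k} \<rightarrow> mspace Y)" using S(1) by auto
next
  fix S assume "S \<in> (\<lambda>f. f ` {..<k}) ` ({..<k} \<rightarrow> mspace Y)"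
  then show "S \<in> C_sets k Y"
    using assms card_image_le[of "{..<k}"] by (auto simp: C_sets_def lessThan_empty_iff)
qed

text \<open>Direct method: a minimizing sequence of tuples has a convergent subsequence, and
  stability of the cost shows that the limit attains the infimum. The theorem needs this for the
  spaces \<open>Xs n\<close>, since a supremum over no k-means would be minus infinity.\<close>

lemma k_means_nonempty:
  assumes k: "1 \<le> k" and p: "1 \<le> p" and Y: "compact_nmms Y \<nu>"
  shows "k_means p k Y \<nu> \<noteq> {}"
proof -
  have cs: "compact_space (mtopology_of Y)" and se: "sets \<nu> = sets (mborel Y)"
    and ne: "mspace Y \<noteq> {}"
    using Y prob_space.not_empty by (auto simp: compact_nmms_def)
  obtain D where D: "\<And>a b. a \<in> mspace Y \<Longrightarrow> b \<in> mspace Y \<Longrightarrow> mdist Y a b \<le> D"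
    using compact_mdist_bounded[OF cs] by blast
  define V where "V = (\<lambda>S. Phi p Y S \<nu>) ` C_sets k Y"
  have bdd: "bdd_below V"
    unfolding V_def by (rule bdd_belowI2[where m = 0]) (auto simp: C_sets_def Phi_nonneg)
  have "V \<noteq> {}" using ne k by (auto simp: V_def C_sets_eq_tuples)
  then have "\<exists>x \<in> V. x < Inf V + inverse (real (Suc n))" for n
    by (intro cInf_lessD) auto
  then have "\<exists>f. f \<in> {..<k} \<rightarrow> mspace Y \<and> Phi p Y (f ` {..<k}) \<nu> < Inf V + inverse (real (Suc n))" for n
    unfolding V_def C_sets_eq_tuples[OF k] by auto
  then obtain f where f: "\<And>n. f n \<in> {..<k} \<rightarrow> mspace Y"
    and lt: "\<And>n. Phi p Y (f n ` {..<k}) \<nu> < Inf V + inverse (real (Suc n))" by metis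
  obtain l r where l: "l \<in> {..<k} \<rightarrow> mspace Y" and r: "strict_mono (r :: nat \<Rightarrow> nat)"
    and lim: "(\<lambda>n. \<Sum>i<k. mdist Y (f (r n) i) (l i)) \<longlonglongrightarrow> 0"
    by (rule compact_tuple_convergent_subseq[OF cs, of k f]) (use f in auto)
  let ?e = "\<lambda>n. \<Sum>i<k. mdist Y (f (r n) i) (l i)"
  let ?L = "p * D powr (p - 1)"
  have "Phi p Y (l ` {..<k}) \<nu> \<le> Inf V + inverse (real (Suc (r n))) + ?L * ?e n" for n
  proof -
    have "mdist Y y (l i) \<le> mdist Y y (f (r n) i) + ?e n" if "i \<in> {..<k}" "y \<in> mspace Y" for i y
    proof -
      have "mdist Y y (l i) \<le> mdist Y y (f (r n) i) + mdist Y (f (r n) i) (l i)"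
        using that l f by (intro mdist_triangle) auto
      moreover have "mdist Y (f (r n) i) (l i) \<le> ?e n"
        using that by (intro member_le_sum) auto
      ultimately show ?thesis by linarith
    qed
    \<comment> \<open>The comparison between two spaces is applied to \<open>Y\<close> and itself,
      with the identity as the map. The push-forward is then the original measure.\<close>
    moreover have "(\<lambda>x. x) \<in> \<nu> \<rightarrow>\<^sub>M mborel Y"
      using se measurable_cong_sets[OF se refl] measurable_ident by (auto simp: id_def)
    moreover have "0 \<le> ?e n" by (intro sum_nonneg) auto
    ultimately have "Phi p Y (l ` {..<k}) (distr \<nu> (mborel Y) (\<lambda>x. x))
        \<le> Phi p Y (f (r n) ` {..<k}) \<nu> + ?L * ?e n"
      using k by (intro Phi_distr_le_Phi[OF Y _ _ _ f l p D D]) (auto simp: lessThan_empty_iff)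
    moreover have "distr \<nu> (mborel Y) (\<lambda>x. x) = \<nu>" using se by (intro distr_id2) simp
    ultimately show ?thesis using lt[of "r n"] by simp
  qed
  moreover have "(\<lambda>n. Inf V + inverse (real (Suc (r n))) + ?L * ?e n) \<longlonglongrightarrow> Inf V + 0 + ?L * 0"
    using LIMSEQ_subseq_LIMSEQ[OF LIMSEQ_inverse_real_of_nat r] lim
    by (intro tendsto_intros) (auto simp: o_def)
  ultimately have "Phi p Y (l ` {..<k}) \<nu> \<le> Inf V"
    by (intro LIMSEQ_le_const[where X = "\<lambda>n. Inf V + inverse (real (Suc (r n))) + ?L * ?e n"]) auto
  then have "Phi p Y (l ` {..<k}) \<nu> \<le> Phi p Y A \<nu>" if "A \<in> C_sets k Y" for A
    using that cInf_lower[OF _ bdd, of "Phi p Y A \<nu>"] by (force simp: V_def)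
  then have "l ` {..<k} \<in> k_means p k Y \<nu>"
    using l by (auto simp: k_means_def C_sets_eq_tuples[OF k])
  then show ?thesis by auto
qed

section \<open>Hausdorff distance of finite sets\<close>

lemma point_setdist_le:
  assumes "finite C" "c \<in> C"
  shows "point_setdist X x C \<le> mdist X x c"
  unfolding point_setdist_def using assms by (intro cINF_lower) auto

lemma point_setdist_nonneg: "C \<noteq> {} \<Longrightarrow> 0 \<le> point_setdist X x C"
  unfolding point_setdist_def by (intro cINF_greatest) auto

lemma hausdorff_dist_nonneg:
  assumes "finite A" "A \<noteq> {}" "B \<noteq> {}"
  shows "0 \<le> hausdorff_dist X A B"
proof -
  obtain a where "a \<in> A" using assms by auto
  then have "point_setdist X a B \<le> Max ((\<lambda>a. point_setdist X a B) ` A)"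
    using assms by (intro Max_ge) auto
  then show ?thesis
    using point_setdist_nonneg[OF assms(3), of X a] by (simp add: hausdorff_dist_def)
qed

text \<open>The point with the same index serves as a nearby partner in both directions.\<close>

lemma hausdorff_dist_tuple_le:
  assumes "finite I" "I \<noteq> {}" "\<And>i. i \<in> I \<Longrightarrow> mdist X (f i) (g i) \<le> e"
  shows "hausdorff_dist X (f ` I) (g ` I) \<le> e"
proof -
  have "point_setdist X (f i) (g ` I) \<le> e" "point_setdist X (g i) (f ` I) \<le> e" if "i \<in> I" for i
    using that assms point_setdist_le[of "g ` I" "g i" X "f i"]
      point_setdist_le[of "f ` I" "f i" X "g i"] by (force simp: mdist_commute)+
  then show ?thesis using assms by (auto simp: hausdorff_dist_def)
qed

section \<open>Limits of k-means along subsequences\<close>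

text \<open>The selection lives on an arbitrary subsequence \<open>r\<close>, so that the theorem
  can feed in the indices at which the claim is supposed to fail.\<close>

lemma k_means_subseq_limit:
  fixes Xs :: "nat \<Rightarrow> 'a metric" and X :: "'b metric"
  assumes k: "1 \<le> k" and p: "1 \<le> p"
    and Xs: "\<And>n. compact_nmms (Xs n) (\<mu>s n)" and X: "compact_nmms X \<mu>"
    and conv: "mGH_converges_via Xs \<mu>s X \<mu> \<epsilon> h"
    and r: "strict_mono (r :: nat \<Rightarrow> nat)" and S: "\<And>n. S n \<in> k_means p k (Xs (r n)) (\<mu>s (r n))"
  obtains T s where "T \<in> k_means p k X \<mu>" "strict_mono s"
    "(\<lambda>n. hausdorff_dist X (h (r (s n)) ` S (s n)) T) \<longlonglongrightarrow> 0"
proof -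
  have cs: "compact_space (mtopology_of X)"
    using X by (auto simp: compact_nmms_def)
  have neXs: "mspace (Xs n) \<noteq> {}" for n
    using Xs[of n] prob_space.not_empty by (auto simp: compact_nmms_def)
  have \<epsilon>: "\<epsilon> \<longlonglongrightarrow> 0" and iso: "\<And>n. eps_isometry (Xs n) X (\<epsilon> n) (h n)"
    and hm: "\<And>n. h n \<in> \<mu>s n \<rightarrow>\<^sub>M mborel X"
    and weak: "weakly_converges X (\<lambda>n. distr (\<mu>s n) (mborel X) (h n)) \<mu>"
    using conv by (auto simp: mGH_converges_via_def)
  have hs: "h n x \<in> mspace X" if "x \<in> mspace (Xs n)" for n x
    using iso[of n] that by (auto simp: eps_isometry_def)
  have near: "\<bar>mdist (Xs n) x x' - mdist X (h n x) (h n x')\<bar> < \<epsilon> n"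
    if "x \<in> mspace (Xs n)" "x' \<in> mspace (Xs n)" for n x x'
    using iso[of n] that by (auto simp: eps_isometry_def)
  \<comment> \<open>A single instance of the strict isometry inequality suffices; a point exists
    because the carrier has a probability measure.\<close>
  have \<epsilon>pos: "0 < \<epsilon> n" for n using near[of _ n] neXs[of n] by fastforce
  have dense: "\<exists>x \<in> mspace (Xs n). mdist X y (h n x) < \<epsilon> n" if "y \<in> mspace X" for n y
  proof -
    have "(INF c \<in> h n ` mspace (Xs n). mdist X y c) < \<epsilon> n"
      using iso[of n] that by (auto simp: eps_isometry_def point_setdist_def)
    from cInf_lessD[OF _ this] neXs[of n] show ?thesis by auto
  qed
  obtain D0 where D0: "\<And>a b. a \<in> mspace X \<Longrightarrow> b \<in> mspace X \<Longrightarrow> mdist X a b \<le> D0"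
    using compact_mdist_bounded[OF cs] by blast
  obtain E where E: "\<And>n. norm (\<epsilon> n) \<le> E"
    using BseqE[OF convergent_imp_Bseq[OF convergentI[OF \<epsilon>]]] by metis
  \<comment> \<open>One bound for the diameters of \<open>X\<close> and of all \<open>Xs n\<close>:
    distances in \<open>Xs n\<close> exceed those of the images by less than
    \<open>\<epsilon> n\<close>, which is at most \<open>E\<close>. Hence the stability constant
    \<open>L\<close> below is independent of n.\<close>
  define D where "D = D0 + E"
  have DX: "mdist X a b \<le> D" if "a \<in> mspace X" "b \<in> mspace X" for a b
    using D0[OF that] E[of 0] by (simp add: D_def)
  have DXs: "mdist (Xs n) a b \<le> D" if "a \<in> mspace (Xs n)" "b \<in> mspace (Xs n)" for n a b
    using near[OF that] D0[OF hs[OF that(1)] hs[OF that(2)]] E[of n] by (simp add: D_def)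
  define L where "L = p * D powr (p - 1)"
  have "\<exists>f. f \<in> {..<k} \<rightarrow> mspace (Xs (r n)) \<and> S n = f ` {..<k}" for n
    using S[of n] unfolding k_means_def C_sets_eq_tuples[OF k] by auto
  then obtain f where f: "\<And>n. f n \<in> {..<k} \<rightarrow> mspace (Xs (r n))"
    and Sf: "\<And>n. S n = f n ` {..<k}" by metis
  obtain l s where l: "l \<in> {..<k} \<rightarrow> mspace X" and s: "strict_mono (s :: nat \<Rightarrow> nat)"
    and lim: "(\<lambda>n. \<Sum>i<k. mdist X (h (r (s n)) (f (s n) i)) (l i)) \<longlonglongrightarrow> 0"
    by (rule compact_tuple_convergent_subseq[OF cs, of k "\<lambda>n i. h (r n) (f n i)"])
       (use f hs in \<open>auto simp: Pi_iff\<close>)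
  define e where "e n = (\<Sum>i<k. mdist X (h (r (s n)) (f (s n) i)) (l i))" for n
  define N where "N n = r (s n)" for n
  have e0: "0 \<le> e n" for n unfolding e_def by (intro sum_nonneg) auto
  have e: "mdist X (h (N n) (f (s n) i)) (l i) \<le> e n" if "i < k" for n i
    unfolding e_def N_def using that
    by (intro member_le_sum[of i "{..<k}" "\<lambda>i. mdist X (h (r (s n)) (f (s n) i)) (l i)"]) auto
  have N: "strict_mono N" unfolding N_def using strict_mono_o[OF r s] by (simp add: o_def)
  have f': "f (s n) \<in> {..<k} \<rightarrow> mspace (Xs (N n))" for n
    using f[of "s n"] by (simp add: N_def)
  let ?\<nu> = "\<lambda>n. distr (\<mu>s n) (mborel X) (h n)"
  \<comment> \<open>Weak convergence handles only a fixed integrand, hence a fixed set of centres.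
    This is why the moving centres \<open>h (N n) (f (s n) i)\<close> get replaced by their limits
    \<open>l i\<close>.\<close>
  have Phi_lim: "(\<lambda>n. Phi p X A (?\<nu> (N n))) \<longlonglongrightarrow> Phi p X A \<mu>" if "A \<in> C_sets k X" for A
  proof -
    have A: "finite A" "A \<noteq> {}" "A \<subseteq> mspace X" using that by (auto simp: C_sets_def)
    let ?F = "\<lambda>y. Min ((\<lambda>x. mdist X y x powr p) ` A)"
    have "norm (?F y) \<le> D powr p" if "y \<in> mspace X" for y
    proof -
      have "?F y \<in> (\<lambda>x. mdist X y x powr p) ` A" using A by simp
      then obtain x where x: "x \<in> A" "?F y = mdist X y x powr p" by auto
      show ?thesis unfolding x(2) using DX[OF that, of x] x A p by (auto intro!: powr_mono2)
    qed
    then have "bounded (?F ` mspace X)" unfolding bounded_iff by blast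
    moreover have "continuous_map (mtopology_of X) euclideanreal ?F"
      using A p by (intro continuous_map_Min_mdist_powr) auto
    ultimately have "(\<lambda>n. Phi p X A (?\<nu> n)) \<longlonglongrightarrow> Phi p X A \<mu>"
      using weak unfolding weakly_converges_def Phi_def by blast
    from LIMSEQ_subseq_LIMSEQ[OF this N] show ?thesis by (simp add: o_def)
  qed
  have lC: "l ` {..<k} \<in> C_sets k X" using l by (simp add: C_sets_eq_tuples[OF k])
  have "Phi p X (l ` {..<k}) \<mu> \<le> Phi p X A \<mu>" if A: "A \<in> C_sets k X" for A
  proof -
    obtain a where a: "a \<in> {..<k} \<rightarrow> mspace X" "A = a ` {..<k}"
      using A by (auto simp: C_sets_eq_tuples[OF k])
    \<comment> \<open>The competitor \<open>A\<close> is lifted to \<open>Xs n\<close> coordinate by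
      coordinate. Lifts may coincide, which tuples allow.\<close>
    have "\<exists>b. \<forall>i<k. b i \<in> mspace (Xs n) \<and> mdist X (a i) (h n (b i)) < \<epsilon> n" for n
      using dense[of "a _" n] a(1) by (metis PiE lessThan_iff)
    then obtain b where b: "\<And>n i. i < k \<Longrightarrow> b n i \<in> mspace (Xs n)"
      and ab: "\<And>n i. i < k \<Longrightarrow> mdist X (a i) (h n (b n i)) < \<epsilon> n" by metis
    have bP: "b n \<in> {..<k} \<rightarrow> mspace (Xs n)" for n using b by auto
    \<comment> \<open>The error collects \<open>e n\<close> from replacing the images of the optimal
      centres by \<open>l\<close>, one \<open>\<epsilon> (N n)\<close> from the isometry defect in
      that replacement, and two from lifting \<open>A\<close>: the isometry defect and the distance
      from \<open>a i\<close> to the image of its lift. Optimality of \<open>S (s n)\<close> against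
      the lift joins the two estimates.\<close>
    have step: "Phi p X (l ` {..<k}) (?\<nu> (N n))
        \<le> Phi p X A (?\<nu> (N n)) + L * (e n + 3 * \<epsilon> (N n))" for n
    proof -
      have "Phi p X (l ` {..<k}) (?\<nu> (N n))
          \<le> Phi p (Xs (N n)) (f (s n) ` {..<k}) (\<mu>s (N n)) + L * (e n + \<epsilon> (N n))"
        unfolding L_def
      proof (rule Phi_distr_le_Phi[OF Xs hm _ _ f' l p DXs DX])
        fix i y assume i: "i \<in> {..<k}" and y: "y \<in> mspace (Xs (N n))"
        have fi: "f (s n) i \<in> mspace (Xs (N n))" using f' i by auto
        have "mdist X (h (N n) y) (l i)
            \<le> mdist X (h (N n) y) (h (N n) (f (s n) i)) + mdist X (h (N n) (f (s n) i)) (l i)"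
          using i y l fi hs by (intro mdist_triangle) auto
        then show "mdist X (h (N n) y) (l i) \<le> mdist (Xs (N n)) y (f (s n) i) + (e n + \<epsilon> (N n))"
          using e[of i n] near[OF y fi] i by simp
      qed (use k e0[of n] \<epsilon>pos[of "N n"] in \<open>auto simp: lessThan_empty_iff\<close>)
      also have "Phi p (Xs (N n)) (f (s n) ` {..<k}) (\<mu>s (N n))
          \<le> Phi p (Xs (N n)) (b (N n) ` {..<k}) (\<mu>s (N n))"
        using S[of "s n"] bP[of "N n"]
        unfolding k_means_def C_sets_eq_tuples[OF k] Sf N_def by auto
      also have "\<dots> \<le> Phi p X A (?\<nu> (N n)) + L * (2 * \<epsilon> (N n))"
        unfolding L_def a(2)
      proof (rule Phi_le_Phi_distr[OF Xs hm _ _ bP a(1) p DXs DX])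
        fix i y assume i: "i \<in> {..<k}" and y: "y \<in> mspace (Xs (N n))"
        have bi: "b (N n) i \<in> mspace (Xs (N n))" using b i by auto
        have "mdist X (h (N n) y) (h (N n) (b (N n) i))
            \<le> mdist X (h (N n) y) (a i) + mdist X (a i) (h (N n) (b (N n) i))"
          using i y a bi hs by (intro mdist_triangle) auto
        then show "mdist (Xs (N n)) y (b (N n) i) \<le> mdist X (h (N n) y) (a i) + 2 * \<epsilon> (N n)"
          using near[OF y bi] ab[of i "N n"] i by simp
      qed (use k \<epsilon>pos[of "N n"] in \<open>auto simp: lessThan_empty_iff\<close>)
      finally show ?thesis by (simp add: algebra_simps)
    qed
    have "(\<lambda>n. \<epsilon> (N n)) \<longlonglongrightarrow> 0" using LIMSEQ_subseq_LIMSEQ[OF \<epsilon> N] by (simp add: o_def)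
    moreover have "e \<longlonglongrightarrow> 0" using lim by (simp add: e_def[abs_def])
    ultimately have "(\<lambda>n. Phi p X A (?\<nu> (N n)) + L * (e n + 3 * \<epsilon> (N n)))
        \<longlonglongrightarrow> Phi p X A \<mu> + L * (0 + 3 * 0)"
      using Phi_lim[OF A] by (intro tendsto_intros)
    then show ?thesis
      using LIMSEQ_le[OF Phi_lim[OF lC]] step by fastforce
  qed
  then have "l ` {..<k} \<in> k_means p k X \<mu>" using lC by (simp add: k_means_def)
  moreover have "(\<lambda>n. hausdorff_dist X (h (r (s n)) ` S (s n)) (l ` {..<k})) \<longlonglongrightarrow> 0"
  proof (rule tendsto_sandwich[OF _ _ tendsto_const])
    show "e \<longlonglongrightarrow> 0" using lim by (simp add: e_def[abs_def])
    show "\<forall>\<^sub>F n in sequentially. 0 \<le> hausdorff_dist X (h (r (s n)) ` S (s n)) (l ` {..<k})"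
      using k unfolding Sf
      by (intro always_eventually allI hausdorff_dist_nonneg) (auto simp: lessThan_empty_iff)
    show "\<forall>\<^sub>F n in sequentially. hausdorff_dist X (h (r (s n)) ` S (s n)) (l ` {..<k}) \<le> e n"
      using k e unfolding Sf image_image
      by (intro always_eventually allI hausdorff_dist_tuple_le) (auto simp: N_def lessThan_empty_iff)
  qed
  ultimately show thesis using s that by blast
qed

section \<open>Convergence of the one-sided distance between sets of k-means\<close>

theorem theorem2p1:
  fixes k :: nat and p :: real
    and Xs :: "nat \<Rightarrow> 'a metric" and \<mu>s :: "nat \<Rightarrow> 'a measure"
    and X :: "'b metric" and \<mu> :: "'b measure"
    and \<epsilon> :: "nat \<Rightarrow> real" and h :: "nat \<Rightarrow> 'a \<Rightarrow> 'b"
  assumes "k \<ge> 1"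
    and "\<And>n. compact_nmms (Xs n) (\<mu>s n)"
    and "compact_nmms X \<mu>"
    and "mGH_converges Xs \<mu>s X \<mu>"
    and "mGH_converges_via Xs \<mu>s X \<mu> \<epsilon> h"
    and "p \<ge> 1"
  shows "(\<lambda>n. SUP S\<^sub>n\<in>k_means p k (Xs n) (\<mu>s n).
                INF S\<in>k_means p k X \<mu>. ereal (hausdorff_dist X (h n ` S\<^sub>n) S)) \<longlonglongrightarrow> 0"
proof -
  let ?F = "\<lambda>n. SUP S\<^sub>n\<in>k_means p k (Xs n) (\<mu>s n).
                INF S\<in>k_means p k X \<mu>. ereal (hausdorff_dist X (h n ` S\<^sub>n) S)"
  have nonneg: "0 \<le> ?F n" for n
  proof -
    obtain S\<^sub>n where S\<^sub>n: "S\<^sub>n \<in> k_means p k (Xs n) (\<mu>s n)"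
      using k_means_nonempty[OF assms(1,6,2)] by blast
    then have "0 \<le> (INF S\<in>k_means p k X \<mu>. ereal (hausdorff_dist X (h n ` S\<^sub>n) S))"
      by (intro INF_greatest)
        (auto simp: k_means_def C_sets_def zero_ereal_def intro!: hausdorff_dist_nonneg)
    also have "\<dots> \<le> ?F n" using S\<^sub>n by (rule SUP_upper)
    finally show ?thesis .
  qed
  \<comment> \<open>Failure for infinitely many n gives a subsequence of bad indices. The supremum
    may not be attained, but exceeding \<open>\<delta>\<close> already yields one set of k-means
    whose infimum exceeds \<open>\<delta>\<close>.\<close>
  have upper: "\<forall>\<^sub>F n in sequentially. ?F n \<le> ereal \<delta>" if "0 < \<delta>" for \<delta>
  proof (rule ccontr)
    assume "\<not> ?thesis"
    then have "\<forall>m. \<exists>n>m. \<not> ?F n \<le> ereal \<delta>"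
      by (simp add: not_eventually frequently_sequentially) (meson Suc_le_lessD)
    then have inf: "infinite {n. \<not> ?F n \<le> ereal \<delta>}"
      unfolding infinite_nat_iff_unbounded by simp
    obtain r :: "nat \<Rightarrow> nat" where r: "strict_mono r" and "\<And>n. \<not> ?F (r n) \<le> ereal \<delta>"
      using infinite_enumerate[OF inf] by auto
    then have "\<exists>S \<in> k_means p k (Xs (r n)) (\<mu>s (r n)).
        ereal \<delta> < (INF T\<in>k_means p k X \<mu>. ereal (hausdorff_dist X (h (r n) ` S) T))" for n
      by (simp add: SUP_le_iff not_le)
    then obtain S where S: "\<And>n. S n \<in> k_means p k (Xs (r n)) (\<mu>s (r n))"
      and far: "\<And>n. ereal \<delta> < (INF T\<in>k_means p k X \<mu>. ereal (hausdorff_dist X (h (r n) ` S n) T))"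
      by metis
    obtain T s where T: "T \<in> k_means p k X \<mu>" and "strict_mono s"
      and lim: "(\<lambda>n. hausdorff_dist X (h (r (s n)) ` S (s n)) T) \<longlonglongrightarrow> 0"
      by (rule k_means_subseq_limit[OF assms(1,6,2,3,5) r, of S]) (use S in auto)
    \<comment> \<open>The limit \<open>T\<close> is itself a set of k-means of \<open>X\<close>, so
      it is a candidate in every infimum, and the distances to it cannot drop below
      \<open>\<delta>\<close>.\<close>
    have "\<delta> < hausdorff_dist X (h (r (s n)) ` S (s n)) T" for n
    proof -
      note far[of "s n"]
      also have "(INF T\<in>k_means p k X \<mu>. ereal (hausdorff_dist X (h (r (s n)) ` S (s n)) T))
          \<le> ereal (hausdorff_dist X (h (r (s n)) ` S (s n)) T)"
        using T by (rule INF_lower)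
      finally show ?thesis by simp
    qed
    moreover from lim \<open>0 < \<delta>\<close> have "\<forall>\<^sub>F n in sequentially. hausdorff_dist X (h (r (s n)) ` S (s n)) T < \<delta>"
      by (rule order_tendstoD)
    ultimately show False
      by (simp add: eventually_sequentially) (meson order.asym order_refl)
  qed
  show "?F \<longlonglongrightarrow> 0"
  proof (rule order_tendstoI)
    fix a :: ereal assume "a < 0"
    then show "\<forall>\<^sub>F n in sequentially. a < ?F n"
      using nonneg by (intro always_eventually allI) (rule less_le_trans)
  next
    fix a :: ereal assume "0 < a"
    \<comment> \<open>A real number strictly between 0 and \<open>a\<close>, which may be infinite,
      turns the non-strict bound into a strict one.\<close>
    then obtain \<delta> where \<delta>: "0 < ereal \<delta>" "ereal \<delta> < a" using ereal_dense2 by blast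
    then have "\<forall>\<^sub>F n in sequentially. ?F n \<le> ereal \<delta>" by (intro upper) simp
    then show "\<forall>\<^sub>F n in sequentially. ?F n < a"
      by eventually_elim (use \<delta> in auto)
  qed
qed

end
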